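(* Let $\mathcal{L}_n$ be a configuration of $n$ lines in the complex projective plane $\mathbb{P}^2$ and let $D\subset\mathbb{P}^2$ be a smooth conic, such that the intersection of $D$ with the union of the lines of $\mathcal{L}_n$ consists of $2n$ distinct points. If there exists a polygon with $2n$ sides well inscribed in $\mathcal{L}_n$ and circumscribed around $D$, then there are infinitely many such polygons (that is, polygons with $2n$ sides well inscribed in $\mathcal{L}_n$ and circumscribed around $D$). In particular, a general point of $\mathcal{L}_n$ (that is, of the union of its lines) is a vertex of such a polygon.
   Context: A polygon with $2n$ sides has $2n$ distinct vertices $A_1,\dots,A_{2n}\in\mathbb{P}^2$, and its $2n$ distinct sides are the lines $(A_iA_{i+1})$, $1\le i\le 2n$, with $A_{2n+1}=A_1$. Such a polygon is well inscribed in a configuration $\mathcal{L}_n$ of $n$ lines if each line of the configuration contains exactly two of the vertices $A_1,\dots,A_{2n}$. It is circumscribed around the smooth conic $D$ if each of its sides is tangent to $D$.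
   Formalization: "Well inscribed" additionally requires that the two vertices on each line be opposite vertices A_i, A_{i+n} of the polygon; with only "exactly two vertices on each line" the claim fails, e.g. for three general lines and the hexagon of tangents from their three intersection points. *)

theory Defs
  imports "HOL-Analysis.Analysis"
begin

text \<open>
  The complex projective plane: points and lines are the linear subspaces of \<open>\<complex>\<^sup>3\<close> of
  dimension 1 and 2, and a point \<open>p\<close> lies on a line \<open>l\<close> iff \<open>p \<subseteq> l\<close>.
  The constants \<open>vec.subspace\<close>, \<open>vec.dim\<close>, \<open>vec.span\<close> refer to the complex vector space structure
  (the unqualified ones would refer to the real one).
\<close>

type_synonym subspace3 = "(complex^3) set"

definition proj_points :: "subspace3 set" where
  "proj_points = {p. vec.subspace p \<and> vec.dim p = 1}"

definition proj_lines :: "subspace3 set" where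
  "proj_lines = {l. vec.subspace l \<and> vec.dim l = 2}"

definition line_through :: "subspace3 \<Rightarrow> subspace3 \<Rightarrow> subspace3" where
  "line_through p q = vec.span (p \<union> q)"

definition points_of :: "subspace3 set \<Rightarrow> subspace3 set" where
  "points_of L = {p \<in> proj_points. \<exists>l\<in>L. p \<subseteq> l}"

definition quadratic_form :: "(complex^3 \<Rightarrow> complex) \<Rightarrow> bool" where
  "quadratic_form F \<longleftrightarrow>
     (\<exists>M :: complex^3^3. \<forall>x. F x = (\<Sum>i\<in>UNIV. \<Sum>j\<in>UNIV. M $ i $ j * x $ i * x $ j))"

definition conic :: "(complex^3 \<Rightarrow> complex) \<Rightarrow> subspace3 set" where
  "conic F = {p \<in> proj_points. \<forall>x\<in>p. F x = 0}"

definition partial_deriv :: "(complex^3 \<Rightarrow> complex) \<Rightarrow> 3 \<Rightarrow> complex^3 \<Rightarrow> complex" where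
  "partial_deriv F i x = deriv (\<lambda>t. F (x + t *s axis i 1)) 0"

text \<open>The zero form is excluded, since all its partial derivatives vanish everywhere.\<close>

definition smooth_conic :: "(complex^3 \<Rightarrow> complex) \<Rightarrow> bool" where
  "smooth_conic F \<longleftrightarrow> quadratic_form F \<and>
     (\<forall>x. x \<noteq> 0 \<and> F x = 0 \<longrightarrow> (\<exists>i. partial_deriv F i x \<noteq> 0))"

text \<open>
  The partial derivatives of a quadratic form are linear, so all nonzero \<open>x \<in> p\<close> impose the
  same equation and \<open>x = 0\<close> imposes none.
\<close>

definition tangent_line :: "(complex^3 \<Rightarrow> complex) \<Rightarrow> subspace3 \<Rightarrow> subspace3" where
  "tangent_line F p = {y. \<forall>x\<in>p. (\<Sum>i\<in>UNIV. partial_deriv F i x * y $ i) = 0}"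

definition tangent_to :: "(complex^3 \<Rightarrow> complex) \<Rightarrow> subspace3 \<Rightarrow> bool" where
  "tangent_to F l \<longleftrightarrow> (\<exists>p \<in> conic F. l = tangent_line F p)"

text \<open>
  A polygon is the list of its consecutive vertices, indexed from 0. Each polygon has only
  finitely many such lists (rotations and reversals), so an infinite set of lists means
  infinitely many polygons.
\<close>

definition sides :: "subspace3 list \<Rightarrow> subspace3 list" where
  "sides A = map (\<lambda>i. line_through (A ! i) (A ! (Suc i mod length A))) [0..<length A]"

definition polygon :: "nat \<Rightarrow> subspace3 list \<Rightarrow> bool" where
  "polygon m A \<longleftrightarrow> length A = m \<and> set A \<subseteq> proj_points \<and> distinct A \<and> distinct (sides A)"

definition circumscribed :: "(complex^3 \<Rightarrow> complex) \<Rightarrow> subspace3 list \<Rightarrow> bool" where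
  "circumscribed F A \<longleftrightarrow> (\<forall>s \<in> set (sides A). tangent_to F s)"

text \<open>
  ``Well inscribed'' is read as follows: each line of the configuration contains exactly two of
  the vertices, and these are opposite vertices \<open>A\<^sub>i\<close>, \<open>A\<^sub>i\<^sub>+\<^sub>n\<close> of the \<open>2n\<close>-gon. The second
  clause goes beyond counting vertices; the Poncelet property fails without it, already for three
  general lines \<open>a, b, c\<close>. The two tangents to the conic from each of the points \<open>a \<inter> b\<close>,
  \<open>a \<inter> c\<close>, \<open>b \<inter> c\<close> are the sides of a hexagon having these three points as alternate vertices,
  so every line contains exactly two vertices. Likewise there are hexagons whose successive
  vertices lie on \<open>a, b, a, c, b, c\<close>. In both cases there are only finitely many of them.
  For \<open>n = 2\<close> the second clause is automatic if the sides are tangent to the conic and the lines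
  of the configuration are not.
\<close>

definition exactly_two_vertices :: "subspace3 set \<Rightarrow> subspace3 list \<Rightarrow> bool" where
  "exactly_two_vertices L A \<longleftrightarrow> (\<forall>l\<in>L. card {v \<in> set A. v \<subseteq> l} = 2)"

definition on_opposite_vertices :: "subspace3 set \<Rightarrow> subspace3 list \<Rightarrow> bool" where
  "on_opposite_vertices L A \<longleftrightarrow>
     (\<forall>l\<in>L. \<forall>i j. i < j \<and> j < length A \<and> A ! i \<subseteq> l \<and> A ! j \<subseteq> l \<longrightarrow> j = i + length A div 2)"

definition well_inscribed :: "subspace3 set \<Rightarrow> subspace3 list \<Rightarrow> bool" where
  "well_inscribed L A \<longleftrightarrow> exactly_two_vertices L A \<and> on_opposite_vertices L A"

end

theory Submission
  imports Defs
begin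

text \<open>
  Let \<open>B\<close> be the polar form of the conic. A vertex of a circumscribed polygon is the intersection of
  the tangents at two consecutive tangency points \<open>x\<close> and \<open>y\<close>. Let \<open>q\<close> be the pole of a line that
  is not tangent to the conic. The vertex lies on this line iff the chord \<open>x y\<close> passes through \<open>q\<close>,
  and this means that the orthogonal reflection in \<open>q\<close>, a linear isometry of \<open>B\<close>, takes \<open>x\<close> to \<open>y\<close>
  up to a scalar (\<open>vertex_on_line_iff\<close>). So the tangency points of a polygon whose vertices lie on
  given lines are obtained from the first one by reflecting successively in the poles of these lines.
  All lines of the configuration are admissible: a tangent line would leave fewer than \<open>2 n\<close>
  intersection points (\<open>no_line_tangent\<close>).

  Opposite vertices of the given \<open>2 n\<close>-gon lie on the same line, so the poles repeat with period \<open>n\<close>.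
  The composition \<open>g\<close> of the first \<open>n\<close> reflections thus takes the tangency point 0 to the tangency
  point \<open>n\<close>, and this one back to the tangency point 0. An isometry that exchanges two points of the
  conic is an involution (\<open>swapping_isometry_involution\<close>). Hence the chain of reflections closes after
  \<open>2 n\<close> steps from every starting point of the conic (\<open>chain_closes\<close>).

  It remains to discard the degenerate chains, in which tangency points coincide or a vertex lies on a
  further line. Each degeneration says that two fixed isometries agree at the starting point. They
  differ at the first tangency point of the given polygon, and isometries that agree at three points of
  the conic agree at all points (\<open>isometries_agree\<close>), so only finitely many starting points are bad
  (\<open>finite_not_generic\<close>). Every point of a line of the configuration lies on a tangent to the conic,
  and tracing the chain back from it gives a starting point, from which the point of the line can be
  recovered. So only finitely many points of the lines fail to be vertices
  (\<open>generic_points_are_vertices\<close>). As the lines have infinitely many points and each polygon has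
  finitely many vertices, there are infinitely many polygons.
\<close>

section \<open>Linear dependence in three-dimensional space\<close>

abbreviation pt :: "complex^3 \<Rightarrow> subspace3" where
  "pt x \<equiv> vec.span {x}"

lemma in_pt_iff: "y \<in> pt x \<longleftrightarrow> (\<exists>c. y = c *s x)"
  by (auto simp: vec.span_singleton)

lemma in_span_pair_iff: "z \<in> vec.span {x, y} \<longleftrightarrow> (\<exists>a b. z = a *s x + b *s (y :: complex^3))"
proof -
  have "z \<in> vec.span {x, y} \<longleftrightarrow> (\<exists>a b. z - a *s x = b *s y)"
    unfolding vec.span_insert[of x] by (auto simp: in_pt_iff)
  then show ?thesis
    by (metis add.commute diff_add_cancel add_diff_cancel_left')
qed

lemma self_in_pt [simp]: "x \<in> pt x"
  by (simp add: vec.span_base)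

lemma pt_eq: assumes "y \<in> pt x" "y \<noteq> 0" shows "pt y = pt x"
proof -
  obtain c where c: "y = c *s x" using assms in_pt_iff by blast
  then have "c \<noteq> 0" using assms by auto
  then have "x = (1/c) *s y" by (simp add: c)
  then have "x \<in> pt y" using in_pt_iff by blast
  then show ?thesis using assms
    by (intro vec.span_eq[THEN iffD2]) auto
qed

lemma pt_sym: "y \<in> pt x \<Longrightarrow> y \<noteq> 0 \<Longrightarrow> x \<in> pt y"
  using pt_eq self_in_pt by blast

lemma proj_point_pt: assumes "x \<noteq> 0" shows "pt x \<in> proj_points"
proof -
  have "vec.independent {x}" using assms by simp
  then show ?thesis
    by (simp add: proj_points_def vec.dim_span_eq_card_independent vec.subspace_span)
qed

lemma proj_point_cases:
  assumes "p \<in> proj_points" obtains x where "x \<noteq> 0" "p = pt x"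
proof -
  have p: "vec.subspace p" "vec.dim p = 1" using assms by (auto simp: proj_points_def)
  obtain Bs where B: "Bs \<subseteq> p" "vec.independent Bs" "p \<subseteq> vec.span Bs" "card Bs = 1"
    using vec.basis_exists[of p] p by metis
  then obtain x where x: "Bs = {x}" by (auto simp: card_1_singleton_iff)
  show ?thesis
  proof
    show "x \<noteq> 0" using B(2) x vec.dependent_zero by blast
    show "p = pt x" using B x p vec.span_subspace by metis
  qed
qed

lemma independent_pair:
  assumes "x \<noteq> 0" "y \<notin> pt x" shows "vec.independent {x, y}" "card {x, y} = 2"
proof -
  show "vec.independent {x, y}"
    using vec.independent_insertI[OF assms(2)] assms(1) by (simp add: insert_commute)
  show "card {x, y} = 2" using assms(2) self_in_pt by (cases "x = y") auto
qed

lemma proj_line_span_pair: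
  assumes "x \<noteq> 0" "y \<notin> pt x" shows "vec.span {x, y} \<in> proj_lines"
  unfolding proj_lines_def
  using vec.dim_span_eq_card_independent[OF independent_pair(1)[OF assms]] independent_pair(2)[OF assms]
  by (metis (mono_tags, lifting) mem_Collect_eq vec.subspace_span)

lemma proj_line_eq_span_pair:
  assumes "l \<in> proj_lines" "x \<in> l" "y \<in> l" "x \<noteq> 0" "y \<notin> pt x"
  shows "l = vec.span {x, y}"
proof -
  have "vec.span {x, y} \<subseteq> l"
    using assms by (intro vec.span_minimal) (auto simp: proj_lines_def)
  then show ?thesis
    using vec.subspace_dim_equal[of "vec.span {x, y}" l] assms proj_line_span_pair[OF assms(4,5)]
    by (auto simp: proj_lines_def)
qed

lemma proj_line_cases:
  assumes "l \<in> proj_lines"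
  obtains x y where "x \<noteq> 0" "y \<notin> pt x" "l = vec.span {x, y}"
proof -
  have l: "vec.subspace l" "vec.dim l = 2" using assms by (auto simp: proj_lines_def)
  obtain Bs where B: "Bs \<subseteq> l" "vec.independent Bs" "l \<subseteq> vec.span Bs" "card Bs = 2"
    using vec.basis_exists[of l] l by metis
  then obtain x y where xy: "Bs = {x, y}" "x \<noteq> y" by (auto simp: card_2_iff)
  show ?thesis
  proof
    show "x \<noteq> 0" using B(2) xy vec.dependent_zero by blast
    show "y \<notin> pt x" using B(2) xy vec.independent_insert[of y "{x}"] by (simp add: insert_commute)
    show "l = vec.span {x, y}" using B xy l vec.span_subspace by metis
  qed
qed

lemma subset_iff_pt: "vec.subspace l \<Longrightarrow> pt x \<subseteq> l \<longleftrightarrow> x \<in> l"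
  using vec.span_minimal[of "{x}" l] self_in_pt by blast

text \<open>
  The form in which the dimension 3 is used: a vector is determined by its
  pairings with three independent vectors, and a linear relation holds everywhere once it holds on
  three independent vectors.
\<close>

lemma independent_triple_spans:
  fixes x y z v :: "complex^3"
  assumes "x \<noteq> 0" "y \<notin> pt x" "z \<notin> vec.span {x, y}"
  obtains a b c where "v = a *s x + b *s y + c *s z"
proof -
  have ind: "vec.independent {z, x, y}"
    using vec.independent_insertI[OF assms(3)] independent_pair[OF assms(1,2)] by blast
  have "z \<notin> {x, y}" using assms(3) vec.span_base by blast
  then have c: "card {z, x, y} = 3" using independent_pair[OF assms(1,2)] by simp
  have "UNIV \<subseteq> vec.span {z, x, y}"
    by (rule vec.card_ge_dim_independent[OF _ ind]) (simp_all add: c vec_dim_card del: vec.dim_UNIV)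
  then have "v \<in> vec.span {z, x, y}" by blast
  then obtain k where "v - k *s z \<in> vec.span {x, y}"
    using vec.span_breakdown_eq by blast
  then obtain a b where "v - k *s z = a *s x + b *s y" using in_span_pair_iff by blast
  then have "v = a *s x + b *s y + k *s z" by (simp add: algebra_simps)
  then show ?thesis using that by blast
qed

lemma exists_outside_line: "\<exists>z :: complex^3. z \<notin> vec.span {x, y}"
proof -
  have "vec.dim (vec.span {x, y}) \<le> card {x, y}"
    by (rule vec.dim_le_card) auto
  also have "\<dots> < 3" by (simp add: card_insert_if)
  also have "3 = vec.dim (UNIV :: (complex^3) set)"
    by (simp add: vec_dim_card del: vec.dim_UNIV)
  finally have "vec.span {x, y} \<noteq> (UNIV :: (complex^3) set)" by force
  then show ?thesis by blast
qed

section \<open>Polarity\<close>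

text \<open>
  The form is the polarisation of the equation of the conic. Then \<open>perp x\<close> is the polar line of
  \<open>x\<close>, the isotropic vectors represent the points of the conic, and the polar line of such a point
  is the tangent there.
\<close>

locale polarity =
  fixes B :: "complex^3 \<Rightarrow> complex^3 \<Rightarrow> complex"
  assumes sym: "B x y = B y x"
    and add_left: "B (x + y) z = B x z + B y z"
    and scale_left: "B (c *s x) y = c * B x y"
    and nondegenerate: "(\<And>y. B x y = 0) \<Longrightarrow> x = 0"
begin

lemma add_right: "B z (x + y) = B z x + B z y"
  using sym add_left by metis

lemma scale_right: "B y (c *s x) = c * B y x"
  using sym scale_left by metis

lemma zero_left [simp]: "B 0 y = 0" and zero_right [simp]: "B y 0 = 0"
  using scale_left[of 0 0 y] scale_right[of y 0 0] by auto

lemma diff_left: "B (x - y) z = B x z - B y z"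
  using add_left[of "x - y" y z] by simp

lemma diff_right: "B z (x - y) = B z x - B z y"
  using sym diff_left by metis

lemmas bilinear = add_left add_right scale_left scale_right diff_left diff_right

definition perp :: "complex^3 \<Rightarrow> subspace3" where
  "perp x = {y. B x y = 0}"

definition isotropic :: "complex^3 \<Rightarrow> bool" where
  "isotropic x \<longleftrightarrow> x \<noteq> 0 \<and> B x x = 0"

lemma in_perp_iff: "y \<in> perp x \<longleftrightarrow> B x y = 0"
  by (simp add: perp_def)

lemma subspace_perp: "vec.subspace (perp x)"
  by (auto simp: vec.subspace_def perp_def bilinear)

lemma pt_subset_perp: "pt y \<subseteq> perp x \<longleftrightarrow> B x y = 0"
  using subset_iff_pt[OF subspace_perp] by (simp add: in_perp_iff)

lemma perp_cong: "pt x = pt y \<Longrightarrow> perp x = perp y"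
  using in_pt_iff[of x y] in_pt_iff[of y x] self_in_pt
  by (auto simp: perp_def scale_left)

lemma orthogonal_to_triple:
  assumes "x \<noteq> 0" "y \<notin> pt x" "z \<notin> vec.span {x, y}" "B a x = 0" "B a y = 0" "B a z = 0"
  shows "a = 0"
proof (rule nondegenerate)
  fix v
  obtain c d e where "v = c *s x + d *s y + e *s z"
    using independent_triple_spans[OF assms(1-3)] .
  then show "B a v = 0" using assms by (simp add: bilinear)
qed

lemma perp_pair_eq_pt:
  assumes "x \<noteq> 0" "y \<notin> pt x" "a \<noteq> 0" "B x a = 0" "B y a = 0"
  shows "perp x \<inter> perp y = pt a"
proof -
  obtain w where w: "w \<notin> vec.span {x, y}" using exists_outside_line by blast
  have nz: "B a w \<noteq> 0"
    using orthogonal_to_triple[OF assms(1,2) w, of a] assms by (auto simp: sym)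
  have "b \<in> pt a" if "B x b = 0" "B y b = 0" for b
  proof -
    have "b - (B b w / B a w) *s a = 0"
      by (rule orthogonal_to_triple[OF assms(1,2) w])
        (use that assms nz in \<open>auto simp: bilinear sym[of _ x] sym[of _ y]\<close>)
    then show ?thesis using in_pt_iff by fastforce
  qed
  moreover have "pt a \<subseteq> perp x \<inter> perp y" using assms pt_subset_perp by simp
  ultimately show ?thesis by (auto simp: in_perp_iff)
qed

text \<open>
  Two linear equations in three unknowns: otherwise adding a third, identically zero component to
  the pair of pairings would give an injective endomorphism that is not surjective.
\<close>

lemma exists_orthogonal_to_pair: "\<exists>a. a \<noteq> 0 \<and> B x a = 0 \<and> B y a = 0"
proof (rule ccontr)
  assume no: "\<not> ?thesis"
  define f :: "complex^3 \<Rightarrow> complex^3"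
    where "f a = (\<chi> i. if i = 1 then B x a else if i = 2 then B y a else 0)" for a
  have lin: "Vector_Spaces.linear (*s) (*s) f"
    by unfold_locales (auto simp: f_def vec_eq_iff bilinear algebra_simps)
  have "inj f"
  proof (rule injI)
    fix a b assume "f a = f b"
    then have "f a $ 1 = f b $ 1" "f a $ 2 = f b $ 2" by simp_all
    then have "B x (a - b) = 0" "B y (a - b) = 0" by (simp_all add: f_def bilinear)
    then show "a = b" using no by auto
  qed
  then have "surj f" using vec.linear_injective_imp_surjective[OF lin] by blast
  then obtain a where "f a = axis 3 1" by (metis surjD)
  then have "f a $ 3 = 1" by simp
  then show False by (simp add: f_def)
qed

lemma proj_line_perp: assumes "q \<noteq> 0" shows "perp q \<in> proj_lines"
proof -
  obtain a where a: "a \<noteq> 0" "B q a = 0" using exists_orthogonal_to_pair by blast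
  obtain c where c: "B q c \<noteq> 0" using nondegenerate[of q] assms by blast
  have "\<exists>b. B q b = 0 \<and> b \<notin> pt a"
  proof (rule ccontr)
    assume no: "\<not> ?thesis"
    obtain v where v: "v \<notin> vec.span {a, c}" using exists_outside_line by blast
    have "v - (B q v / B q c) *s c \<in> pt a" using no c by (auto simp: bilinear)
    then obtain k where "v - (B q v / B q c) *s c = k *s a" using in_pt_iff by blast
    then have "v = k *s a + (B q v / B q c) *s c" by (simp add: algebra_simps)
    then show False using v in_span_pair_iff by blast
  qed
  then obtain b where b: "B q b = 0" "b \<notin> pt a" by blast
  have "perp q = vec.span {a, b}"
  proof
    show "vec.span {a, b} \<subseteq> perp q"
      using a b by (intro vec.span_minimal subspace_perp) (auto simp: in_perp_iff)
    show "perp q \<subseteq> vec.span {a, b}"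
      using orthogonal_to_triple[OF a(1) b(2), of _ q] a b assms
      unfolding in_perp_iff subset_iff by blast
  qed
  then show ?thesis using proj_line_span_pair[OF a(1) b(2)] by simp
qed

lemma proj_line_has_pole:
  assumes "l \<in> proj_lines" obtains q where "q \<noteq> 0" "l = perp q"
proof -
  obtain x y where xy: "x \<noteq> 0" "y \<notin> pt x" "l = vec.span {x, y}"
    using proj_line_cases[OF assms] .
  obtain q where q: "q \<noteq> 0" "B x q = 0" "B y q = 0" using exists_orthogonal_to_pair by blast
  then have "perp q = l"
    using proj_line_eq_span_pair[OF proj_line_perp[OF q(1)], of x y] xy
    by (auto simp: in_perp_iff sym)
  then show ?thesis using that q by blast
qed

section \<open>Points of the conic\<close>

text \<open>A tangent meets the conic only at its point of tangency.\<close>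

lemma isotropic_orthogonal:
  assumes "isotropic x" "isotropic y" "B x y = 0" shows "y \<in> pt x"
proof (rule ccontr)
  assume n: "y \<notin> pt x"
  have x: "x \<noteq> 0" "B x x = 0" "y \<noteq> 0" "B y y = 0" using assms by (auto simp: isotropic_def)
  have "perp x \<inter> perp y = pt x" by (rule perp_pair_eq_pt[OF x(1) n x(1)]) (use x assms sym in auto)
  moreover have "y \<in> perp x \<inter> perp y" using x assms by (auto simp: in_perp_iff)
  ultimately show False using n by blast
qed

lemma isotropic_pairing:
  assumes "isotropic x" "isotropic y" "y \<notin> pt x" shows "B x y \<noteq> 0"
  using isotropic_orthogonal assms by blast

lemma isotropic_scale: "isotropic x \<Longrightarrow> y \<in> pt x \<Longrightarrow> y \<noteq> 0 \<Longrightarrow> isotropic y"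
  by (auto simp: isotropic_def in_pt_iff scale_left scale_right)

lemma isotropic_not_in_span:
  assumes "isotropic x" "isotropic y" "isotropic z" "y \<notin> pt x" "z \<notin> pt x" "z \<notin> pt y"
  shows "z \<notin> vec.span {x, y}"
proof
  assume "z \<in> vec.span {x, y}"
  then obtain a b where z: "z = a *s x + b *s y" using in_span_pair_iff by blast
  have nz: "B x y \<noteq> 0" using isotropic_pairing assms by blast
  have xx: "B x x = 0" "B y y = 0" using assms by (auto simp: isotropic_def)
  have "0 = B z z" using assms by (simp add: isotropic_def)
  also have "\<dots> = 2 * a * b * B x y" unfolding z by (simp add: bilinear xx sym[of y x])
  finally have "a = 0 \<or> b = 0" using nz by simp
  then show False using assms(5,6) z in_pt_iff by auto
qed

lemma line_meets_conic:
  assumes "l \<in> proj_lines" obtains z where "isotropic z" "z \<in> l"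
proof -
  obtain x y where xy: "x \<noteq> 0" "y \<notin> pt x" "l = vec.span {x, y}"
    using proj_line_cases[OF assms] .
  show ?thesis
  proof (cases "B x x = 0")
    case True
    then show ?thesis using that[of x] xy vec.span_base[of x "{x, y}"] by (auto simp: isotropic_def)
  next
    case False
    \<comment> \<open>a root of the quadratic equation \<open>B (t *s x + y) (t *s x + y) = 0\<close>\<close>
    define t where "t = (csqrt ((B x y)^2 - B x x * B y y) - B x y) / B x x"
    define z where "z = t *s x + 1 *s y"
    have "B x x * B z z = (B x x * t + B x y)^2 - ((B x y)^2 - B x x * B y y)"
      unfolding z_def by (simp add: bilinear sym[of y x] power2_eq_square algebra_simps)
    also have "B x x * t + B x y = csqrt ((B x y)^2 - B x x * B y y)"
      using False by (simp add: t_def)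
    finally have "B z z = 0" using False by simp
    moreover have "z \<in> l" using xy z_def in_span_pair_iff by blast
    moreover have "z \<noteq> 0"
    proof
      assume "z = 0"
      then have "y = (- t) *s x" unfolding z_def by (simp add: eq_neg_iff_add_eq_0 add.commute)
      then show False using xy(2) in_pt_iff by blast
    qed
    ultimately show ?thesis using that by (auto simp: isotropic_def)
  qed
qed


section \<open>Isometries and reflections\<close>

text \<open>
  Isometries of the form permute the points of the conic, so they play the role of the Moebius
  transformations of a parametrised conic. The reflection in a non-isotropic \<open>q\<close> induces the
  involution of the conic that exchanges the two points on each line through \<open>q\<close>.
\<close>

definition isometry :: "(complex^3 \<Rightarrow> complex^3) \<Rightarrow> bool" where
  "isometry M \<longleftrightarrow> (\<forall>x y. M (x + y) = M x + M y) \<and> (\<forall>c x. M (c *s x) = c *s M x)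
     \<and> (\<forall>x y. B (M x) (M y) = B x y)"

lemma isometry_add: "isometry M \<Longrightarrow> M (x + y) = M x + M y"
  and isometry_scale: "isometry M \<Longrightarrow> M (c *s x) = c *s M x"
  and isometry_form: "isometry M \<Longrightarrow> B (M x) (M y) = B x y"
  by (auto simp: isometry_def)

lemma isometry_id: "isometry (\<lambda>x. x)"
  by (simp add: isometry_def)

lemma isometry_compose: "isometry M \<Longrightarrow> isometry N \<Longrightarrow> isometry (\<lambda>x. M (N x))"
  by (simp add: isometry_def)

lemma isometry_eq_0_iff: assumes "isometry M" shows "M x = 0 \<longleftrightarrow> x = 0"
proof
  assume "M x = 0"
  then have "B x y = 0" for y using isometry_form[OF assms, of x y] by simp
  then show "x = 0" by (rule nondegenerate)
next
  assume "x = 0"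
  then show "M x = 0" using isometry_scale[OF assms, of 0 x] by simp
qed

lemma isometry_isotropic: "isometry M \<Longrightarrow> isotropic (M x) \<longleftrightarrow> isotropic x"
  by (simp add: isotropic_def isometry_eq_0_iff isometry_form)

lemma isometry_in_pt: "isometry M \<Longrightarrow> y \<in> pt x \<Longrightarrow> M y \<in> pt (M x)"
  by (auto simp: in_pt_iff isometry_scale)

definition reflect :: "complex^3 \<Rightarrow> complex^3 \<Rightarrow> complex^3" where
  "reflect q x = x - (2 * B q x / B q q) *s q"

lemma reflect_reflect [simp]:
  assumes "B q q \<noteq> 0" shows "reflect q (reflect q x) = x"
proof -
  have "B q (reflect q x) = - B q x"
    unfolding reflect_def using assms by (simp add: bilinear)
  then show ?thesis by (simp add: reflect_def[of q "reflect q x"]) (simp add: reflect_def)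
qed

lemma isometry_reflect:
  assumes "B q q \<noteq> 0" shows "isometry (reflect q)"
proof -
  have "B (reflect q x) (reflect q y) = B x y" for x y
    unfolding reflect_def using assms by (simp add: bilinear sym[of x q] field_simps)
  moreover have "reflect q (x + y) = reflect q x + reflect q y" for x y
    by (simp add: reflect_def bilinear vec_eq_iff add_divide_distrib algebra_simps)
  moreover have "reflect q (c *s x) = c *s reflect q x" for c x
    by (simp add: reflect_def bilinear vec_eq_iff algebra_simps)
  ultimately show ?thesis unfolding isometry_def by blast
qed

lemma exists_vertex:
  assumes "x \<noteq> 0" "y \<notin> pt x" obtains a where "a \<noteq> 0" "perp x \<inter> perp y = pt a"
  using exists_orthogonal_to_pair[of x y] perp_pair_eq_pt[OF assms] by blast

text \<open>
  The link between incidence and reflections. By polarity the intersection of the tangents at \<open>x\<close>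
  and \<open>y\<close> lies on the polar line of \<open>q\<close> iff \<open>q\<close> lies on the chord \<open>x y\<close>, that is, iff the
  involution defined by \<open>q\<close> exchanges the end points of this chord.
\<close>

lemma vertex_on_line_iff:
  assumes "isotropic x" "isotropic y" "y \<notin> pt x" "B q q \<noteq> 0"
  shows "perp x \<inter> perp y \<subseteq> perp q \<longleftrightarrow> reflect q x \<in> pt y"
proof
  assume sub: "perp x \<inter> perp y \<subseteq> perp q"
  obtain a where a: "a \<noteq> 0" "B x a = 0" "B y a = 0" using exists_orthogonal_to_pair by blast
  then have "B q a = 0" using sub by (auto simp: in_perp_iff)
  then have "q \<in> vec.span {x, y}"
    using orthogonal_to_triple[of x y q a] a assms by (auto simp: isotropic_def sym)
  then obtain r s where q: "q = r *s x + s *s y" using in_span_pair_iff by blast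
  have xx: "B x x = 0" "B y y = 0" using assms by (auto simp: isotropic_def)
  define c where "c = B x y"
  have qq: "B q q = 2 * r * s * c" unfolding q c_def by (simp add: bilinear xx sym[of y x])
  then have nz: "r \<noteq> 0" "s \<noteq> 0" "c \<noteq> 0" using assms(4) by auto
  have "B q x = s * c" unfolding q c_def by (simp add: bilinear xx sym[of y x])
  then have "2 * B q x / B q q = 1 / r" using nz qq by simp
  then have "reflect q x = (- (s / r)) *s y"
    unfolding reflect_def using nz by (simp add: q vec_eq_iff field_simps)
  then show "reflect q x \<in> pt y" using in_pt_iff by blast
next
  assume "reflect q x \<in> pt y"
  then obtain c where c: "reflect q x = c *s y" using in_pt_iff by blast
  show "perp x \<inter> perp y \<subseteq> perp q"
  proof
    fix a assume "a \<in> perp x \<inter> perp y"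
    then have a: "B x a = 0" "B y a = 0" by (auto simp: in_perp_iff)
    have "2 * B q x / B q q \<noteq> 0"
    proof
      assume "2 * B q x / B q q = 0"
      then have "reflect q x = x" unfolding reflect_def by (simp only: vector_smult_lzero diff_zero)
      then have "x = c *s y" using c by simp
      then show False using assms pt_sym[of x y] in_pt_iff[of x y] by (auto simp: isotropic_def)
    qed
    moreover have "B (reflect q x) a = 0" using c a by (simp add: bilinear)
    then have "2 * B q x / B q q * B q a = 0" using a by (simp add: reflect_def bilinear)
    ultimately show "a \<in> perp q" by (simp add: in_perp_iff)
  qed
qed

text \<open>
  The isometric version of the fact that a Moebius transformation with a cycle of length two is an
  involution. The scalars by which \<open>h\<close> moves \<open>x\<close> to \<open>y\<close> and back have product 1 because \<open>B x y\<close>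
  is preserved and nonzero. The intersection \<open>b\<close> of the tangents at \<open>x\<close> and \<open>y\<close> is fixed up
  to a scalar, which squares to 1 because \<open>B b b\<close> is preserved and nonzero.
\<close>

lemma swapping_isometry_involution:
  assumes "isometry h" "isotropic x" "isotropic y" "y \<notin> pt x" "h x \<in> pt y" "h y \<in> pt x"
  shows "h (h v) = v"
proof -
  obtain \<alpha> \<beta> where h: "h x = \<alpha> *s y" "h y = \<beta> *s x"
    using assms(5,6) unfolding in_pt_iff by blast
  have c: "B x y \<noteq> 0" by (rule isotropic_pairing[OF assms(2-4)])
  have "B (h x) (h y) = \<alpha> * \<beta> * B x y" by (simp add: h bilinear sym[of y x])
  then have ab: "\<alpha> * \<beta> = 1" using isometry_form[OF assms(1)] c by simp
  then have nz: "\<alpha> \<noteq> 0" "\<beta> \<noteq> 0" by (metis mult_zero_left zero_neq_one, metis mult_zero_right zero_neq_one ab)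
  obtain b where b: "b \<noteq> 0" "B x b = 0" "B y b = 0" using exists_orthogonal_to_pair by blast
  have x: "x \<noteq> 0" "B x x = 0" "B y y = 0" using assms(2,3) by (simp_all add: isotropic_def)
  have "B (h x) (h b) = 0" "B (h y) (h b) = 0" by (simp_all only: isometry_form[OF assms(1)] b)
  then have "B x (h b) = 0" "B y (h b) = 0" using nz by (simp_all add: h scale_left)
  then have "h b \<in> pt b"
    unfolding perp_pair_eq_pt[OF x(1) assms(4) b, symmetric] by (simp add: in_perp_iff)
  then obtain \<gamma> where g: "h b = \<gamma> *s b" using in_pt_iff by blast
  have out: "b \<notin> vec.span {x, y}"
  proof
    assume "b \<in> vec.span {x, y}"
    then obtain r s where rs: "b = r *s x + s *s y" using in_span_pair_iff by blast
    then have "s * B x y = 0" "r * B x y = 0" using b x by (auto simp: bilinear sym[of y x])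
    then show False using rs c b by simp
  qed
  have "B b b \<noteq> 0"
    using orthogonal_to_triple[OF x(1) assms(4) out, of b] b sym[of b x] sym[of b y] by auto
  moreover have "B (h b) (h b) = \<gamma> * \<gamma> * B b b" by (simp add: g bilinear)
  ultimately have gg: "\<gamma> * \<gamma> = 1" using isometry_form[OF assms(1)] by simp
  obtain r s t where v: "v = r *s x + s *s y + t *s b"
    using independent_triple_spans[OF x(1) assms(4) out] .
  have "h (h v) = (r * (\<alpha> * \<beta>)) *s x + (s * (\<alpha> * \<beta>)) *s y + (t * (\<gamma> * \<gamma>)) *s b"
    unfolding v isometry_add[OF assms(1)] isometry_scale[OF assms(1)] h g
    by (simp only: vector_smult_assoc mult.assoc mult.commute[of \<beta> \<alpha>])
  then show ?thesis by (simp only: ab gg mult_1_right v)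
qed

text \<open>
  The isometric version of the fact that a Moebius transformation is determined by three values:
  preservation of the form makes the three pairwise products of the scalars equal to 1, so the
  scalars coincide, and the three points span the space.
\<close>

lemma isometries_agree:
  assumes "isometry M" "isometry N"
    and "isotropic x" "isotropic y" "isotropic z" "y \<notin> pt x" "z \<notin> pt x" "z \<notin> pt y"
    and "M x \<in> pt (N x)" "M y \<in> pt (N y)" "M z \<in> pt (N z)"
  shows "M v \<in> pt (N v)"
proof -
  obtain a b c where m: "M x = a *s N x" "M y = b *s N y" "M z = c *s N z"
    using assms(9-11) unfolding in_pt_iff by blast
  have "a * b * B x y = B x y" "a * c * B x z = B x z" "b * c * B y z = B y z"
    using isometry_form[OF assms(1), of x y] isometry_form[OF assms(1), of x z]
      isometry_form[OF assms(1), of y z]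
    unfolding m scale_left scale_right isometry_form[OF assms(2)]
    by (simp_all add: mult.commute)
  then have one: "a * b = 1" "a * c = 1" "b * c = 1"
    by (simp_all add: isotropic_pairing assms(3-8))
  have "a = a * (b * c)" using one by simp
  also have "\<dots> = (a * b) * c" by (simp only: mult.assoc)
  finally have "a = c" using one by simp
  have "b = b * (a * c)" using one by simp
  also have "\<dots> = (b * c) * a" by (simp only: mult_ac)
  finally have "a = b" using one by simp
  have "x \<noteq> 0" using assms(3) by (simp add: isotropic_def)
  then obtain r s t where v: "v = r *s x + s *s y + t *s z"
    using independent_triple_spans[OF _ assms(6) isotropic_not_in_span[OF assms(3-8)]] by blast
  have m': "M x = a *s N x" "M y = a *s N y" "M z = a *s N z"
    using m \<open>a = b\<close> \<open>a = c\<close> by simp_all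
  have "M v = a *s N v"
    unfolding v isometry_add[OF assms(1)] isometry_scale[OF assms(1)] isometry_add[OF assms(2)]
        isometry_scale[OF assms(2)] m' by (simp add: vec_eq_iff algebra_simps)
  then show ?thesis using in_pt_iff by blast
qed

lemma three_conic_points:
  assumes "\<not> (finite S \<and> card S \<le> 2)" "\<And>P. P \<in> S \<Longrightarrow> \<exists>x. isotropic x \<and> P = pt x \<and> Q x"
  obtains x y z where "isotropic x" "isotropic y" "isotropic z" "y \<notin> pt x" "z \<notin> pt x" "z \<notin> pt y"
    "Q x" "Q y" "Q z"
proof -
  obtain T where T: "T \<subseteq> S" "card T = 3"
  proof (cases "finite S")
    case True
    then have "3 \<le> card S" using assms(1) by simp
    then show ?thesis using obtain_subset_with_card_n that by metis
  next
    case False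
    then show ?thesis using infinite_arbitrarily_large that by metis
  qed
  then obtain P1 P2 P3 where P: "P1 \<in> S" "P2 \<in> S" "P3 \<in> S" "P1 \<noteq> P2" "P1 \<noteq> P3" "P2 \<noteq> P3"
    by (auto simp: card_3_iff)
  obtain x y z where xyz: "isotropic x" "P1 = pt x" "Q x" "isotropic y" "P2 = pt y" "Q y"
    "isotropic z" "P3 = pt z" "Q z"
    using assms(2) P(1-3) by metis
  then have "y \<notin> pt x" "z \<notin> pt x" "z \<notin> pt y" using P pt_eq by (auto simp: isotropic_def)
  then show ?thesis using that xyz by blast
qed

lemma finite_agreement:
  assumes "isometry M" "isometry N" "M w \<notin> pt (N w)"
  shows "finite {pt x | x. isotropic x \<and> M x \<in> pt (N x)}" (is "finite ?S")
proof (rule ccontr)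
  assume inf: "infinite ?S"
  have Q: "\<And>P. P \<in> ?S \<Longrightarrow> \<exists>x. isotropic x \<and> P = pt x \<and> M x \<in> pt (N x)" by auto
  obtain x y z where "isotropic x" "isotropic y" "isotropic z" "y \<notin> pt x" "z \<notin> pt x" "z \<notin> pt y"
    "M x \<in> pt (N x)" "M y \<in> pt (N y)" "M z \<in> pt (N z)"
    using three_conic_points[OF _ Q] inf by blast
  then show False using isometries_agree assms by blast
qed

lemma line_conic_card:
  assumes "l \<in> proj_lines"
  shows "finite {pt x | x. isotropic x \<and> x \<in> l} \<and> card {pt x | x. isotropic x \<and> x \<in> l} \<le> 2"
    (is "finite ?S \<and> _")
proof (rule ccontr)
  assume no: "\<not> ?thesis"
  have Q: "\<And>P. P \<in> ?S \<Longrightarrow> \<exists>x. isotropic x \<and> P = pt x \<and> x \<in> l" by auto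
  obtain x y z where *: "isotropic x" "isotropic y" "isotropic z" "y \<notin> pt x" "z \<notin> pt x" "z \<notin> pt y"
    "x \<in> l" "y \<in> l" "z \<in> l"
    using three_conic_points[OF no Q] by blast
  then have "l = vec.span {x, y}"
    using proj_line_eq_span_pair[OF assms, of x y] by (auto simp: isotropic_def)
  then show False using isotropic_not_in_span * by blast
qed

lemma tangent_line_conic:
  assumes "isotropic q" shows "{pt x | x. isotropic x \<and> x \<in> perp q} = {pt q}"
proof -
  have "pt x = pt q" if "isotropic x" "x \<in> perp q" for x
    using that assms isotropic_orthogonal[of q x] pt_eq by (auto simp: in_perp_iff isotropic_def)
  moreover have "q \<in> perp q" using assms by (simp add: in_perp_iff isotropic_def)
  ultimately show ?thesis using assms by blast
qed

text \<open>
  Each line meets the conic in at most two points, a tangent in only one, so the maximal number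
  of intersection points leaves no room for tangents.
\<close>

lemma no_line_tangent:
  assumes "L \<subseteq> proj_lines" "finite L"
    and "card {pt x | x. isotropic x \<and> (\<exists>l\<in>L. x \<in> l)} = 2 * card L"
    and "perp q \<in> L" "q \<noteq> 0"
  shows "B q q \<noteq> 0"
proof
  assume "B q q = 0"
  then have q: "isotropic q" using assms by (simp add: isotropic_def)
  let ?S = "\<lambda>l. {pt x | x. isotropic x \<and> x \<in> l}"
  have "card {pt x | x. isotropic x \<and> (\<exists>l\<in>L. x \<in> l)} = card (\<Union>l\<in>L. ?S l)"
    by (rule arg_cong[where f=card]) blast
  also have "\<dots> \<le> (\<Sum>l\<in>L. card (?S l))" by (rule card_UN_le[OF assms(2)])
  also have "\<dots> < (\<Sum>l\<in>L. 2)"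
  proof (rule sum_strict_mono_ex1[OF assms(2)])
    show "\<forall>l\<in>L. card (?S l) \<le> 2" using line_conic_card assms(1) by blast
    have "card (?S (perp q)) < 2" unfolding tangent_line_conic[OF q] by simp
    then show "\<exists>l\<in>L. card (?S l) < 2" using assms(4) by blast
  qed
  finally show False using assms(3) by simp
qed

section \<open>Chains of reflections\<close>

text \<open>
  If \<open>q k\<close> is the pole of the line that carries the \<open>k\<close>-th vertex of a circumscribed polygon, this
  map takes the tangency point before vertex 0 to the one before vertex \<open>k\<close>.
\<close>

primrec reflections :: "(nat \<Rightarrow> complex^3) \<Rightarrow> nat \<Rightarrow> complex^3 \<Rightarrow> complex^3" where
  "reflections q 0 x = x"
| "reflections q (Suc k) x = reflect (q k) (reflections q k x)"

lemma isometry_reflections: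
  assumes "\<And>k. B (q k) (q k) \<noteq> 0" shows "isometry (reflections q k)"
proof (induction k)
  case 0
  show ?case using isometry_id by simp
next
  case (Suc k)
  show ?case using isometry_compose[OF isometry_reflect[OF assms] Suc] by simp
qed

lemma isotropic_reflections_iff:
  assumes "\<And>k. B (q k) (q k) \<noteq> 0"
  shows "isotropic (reflections q k x) \<longleftrightarrow> isotropic x"
  using isometry_isotropic[OF isometry_reflections[of q k, OF assms], of x] .

lemma surj_reflections:
  assumes "\<And>k. B (q k) (q k) \<noteq> 0" shows "\<exists>x. reflections q k x = z"
proof (induction k arbitrary: z)
  case (Suc k)
  obtain x where "reflections q k x = reflect (q k) z" using Suc by blast
  then have "reflections q (Suc k) x = z" using assms by simp
  then show ?case by blast
qed simp

lemma reflections_add_period: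
  assumes "\<And>k. q (k + n) = q k"
  shows "reflections q (k + n) x = reflections q k (reflections q n x)"
  by (induction k) (simp_all add: assms)

lemma chain_orbit:
  assumes q: "\<And>k. B (q k) (q k) \<noteq> 0" "\<And>k. q (k + m) = q k"
    and step: "\<And>k. reflect (q k) (y k) \<in> pt (y (Suc k))"
  shows "reflections q k (y m) \<in> pt (y (k + m))"
proof (induction k)
  case (Suc k)
  have "reflections q (Suc k) (y m) \<in> pt (reflect (q k) (y (k + m)))"
    using isometry_in_pt[OF isometry_reflect[OF q(1)] Suc] by simp
  moreover have "\<dots> \<subseteq> pt (y (Suc k + m))"
    using step[of "k + m"] q(2) subset_iff_pt[OF vec.subspace_span] by simp
  ultimately show ?case by blast
qed simp

text \<open>
  Closing is independent of the starting point: opposite vertices lie on the same line, so the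
  composition of the first \<open>n\<close> reflections takes \<open>y 0\<close> to \<open>y n\<close> and, being repeated for the second
  half of the polygon, takes \<open>y n\<close> back to \<open>y 0\<close>. Hence it is an involution.
\<close>

lemma chain_closes:
  assumes q: "\<And>k. B (q k) (q k) \<noteq> 0" "\<And>k. q (k + n) = q k"
    and y: "\<And>k. isotropic (y k)" "y (n + n) = y 0" "y n \<notin> pt (y 0)"
    and step: "\<And>k. reflect (q k) (y k) \<in> pt (y (Suc k))"
  shows "reflections q (k + 2 * n) v = reflections q k v"
proof -
  have "reflections q n (reflections q n v) = v" for v
    by (rule swapping_isometry_involution[OF isometry_reflections[OF q(1)] y(1) y(1) y(3)])
      (use chain_orbit[of q 0 y, OF q(1) _ step, of n] chain_orbit[of q n y, OF q(1) q(2) step, of n] y(2)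
       in auto)
  then show ?thesis
    using reflections_add_period[of q n, OF q(2)] by (simp add: mult_2 flip: add.assoc)
qed

end


section \<open>Lines and opposite vertices\<close>

lemma mod_eq_iff_half: "(k::nat) < 2 * n \<Longrightarrow> i < n \<Longrightarrow> k mod n = i \<longleftrightarrow> k = i \<or> k = i + n"
  by (cases "k < n") (auto simp: le_mod_geq)

lemma periodic_mod:
  fixes f :: "nat \<Rightarrow> 'a"
  assumes "\<And>k. f (k + m) = f k" shows "f (k mod m) = f k"
proof -
  have "f (r + m * d) = f r" for r d
  proof (induction d)
    case (Suc d)
    have "r + m * Suc d = (r + m * d) + m" by simp
    then show ?case using Suc assms by metis
  qed simp
  from this[of "k mod m" "k div m"] show ?thesis by simp
qed

lemma Suc_mod_neq: "m \<ge> 2 \<Longrightarrow> k mod m \<noteq> Suc k mod (m::nat)"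
  by (auto simp: mod_Suc)

lemma periodic_noncoincident:
  fixes y :: "nat \<Rightarrow> complex^3"
  assumes "m > 0" and per: "\<And>k. y (k + m) = y k"
    and "\<And>i j. i < m \<Longrightarrow> j < m \<Longrightarrow> i \<noteq> j \<Longrightarrow> y j \<notin> pt (y i)"
    and "i mod m \<noteq> j mod m"
  shows "y j \<notin> pt (y i)"
  using assms(3)[of "i mod m" "j mod m"] assms(1,4) periodic_mod[of y m, OF per] by simp

lemma line_through_pts:
  assumes "a \<noteq> 0" "b \<notin> pt a" shows "line_through (pt a) (pt b) = vec.span {a, b}"
  unfolding line_through_def
proof (rule vec.span_eq[THEN iffD2], intro conjI)
  show "pt a \<union> pt b \<subseteq> vec.span {a, b}"
    using vec.span_mono[of "{a}" "{a, b}"] vec.span_mono[of "{b}" "{a, b}"] by blast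
  show "{a, b} \<subseteq> vec.span (pt a \<union> pt b)"
    using self_in_pt[of a] self_in_pt[of b] vec.span_superset[of "pt a \<union> pt b"] by blast
qed

lemma proj_line_unique:
  assumes "l \<in> proj_lines" "l' \<in> proj_lines" "p \<in> proj_points" "p' \<in> proj_points" "p \<noteq> p'"
    and "p \<subseteq> l" "p' \<subseteq> l" "p \<subseteq> l'" "p' \<subseteq> l'"
  shows "l = l'"
proof -
  obtain a b where a: "a \<noteq> 0" "p = pt a" and b: "b \<noteq> 0" "p' = pt b"
    using proj_point_cases assms(3,4) by metis
  have "b \<notin> pt a" using pt_eq a b assms(5) by blast
  then show ?thesis
    using proj_line_eq_span_pair[OF assms(1), of a b] proj_line_eq_span_pair[OF assms(2), of a b]
      assms(6-9) a b self_in_pt[of a] self_in_pt[of b] by blast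
qed

text \<open>
  Each line carries the vertices \<open>i\<close> and \<open>i + n\<close> for exactly one \<open>i < n\<close>. Two distinct vertices
  determine their line, so these indices are distinct for distinct lines, and as there are \<open>n\<close>
  lines every index occurs.
\<close>

lemma well_inscribed_labelling:
  assumes "polygon (2 * n) A" "well_inscribed L A" "L \<subseteq> proj_lines" "finite L" "card L = n"
  obtains l where "l ` {..<n} = L" "\<And>i k. i < n \<Longrightarrow> k < 2 * n \<Longrightarrow> A ! k \<subseteq> l i \<longleftrightarrow> k mod n = i"
proof -
  have A: "length A = 2 * n" "distinct A" "set A \<subseteq> proj_points"
    using assms(1) by (auto simp: polygon_def)
  have "\<exists>i<n. \<forall>k<2*n. A ! k \<subseteq> l \<longleftrightarrow> k mod n = i" if l: "l \<in> L" for l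
  proof -
    let ?V = "{v \<in> set A. v \<subseteq> l}"
    have "card ?V = 2" using assms(2) l by (simp add: well_inscribed_def exactly_two_vertices_def)
    then obtain u v where uv: "?V = {u, v}" "u \<noteq> v" by (auto simp: card_2_iff)
    then have "u \<in> set A" "v \<in> set A" by blast+
    then obtain i' j' where ij': "i' < 2 * n" "j' < 2 * n" "u = A ! i'" "v = A ! j'"
      using A(1) by (metis in_set_conv_nth)
    define i where "i = min i' j'"
    define j where "j = max i' j'"
    have ij: "?V = {A ! i, A ! j}" "i < j" "j < 2 * n"
      using uv ij' by (auto simp: i_def j_def min_def max_def)
    have on: "A ! k \<subseteq> l \<longleftrightarrow> k = i \<or> k = j" if "k < 2 * n" for k
    proof -
      have "A ! k \<subseteq> l \<longleftrightarrow> A ! k \<in> {A ! i, A ! j}"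
        using that A(1) unfolding ij(1)[symmetric] by simp
      then show ?thesis using that ij A by (simp add: nth_eq_iff_index_eq)
    qed
    have "j = i + length A div 2"
      using assms(2) l ij A(1) on[of i] on[of j]
      unfolding well_inscribed_def on_opposite_vertices_def by auto
    then have j: "j = i + n" using A(1) by simp
    then have "i < n" using ij by simp
    moreover have "\<forall>k<2*n. A ! k \<subseteq> l \<longleftrightarrow> k mod n = i"
      using on j mod_eq_iff_half[OF _ \<open>i < n\<close>] by simp
    ultimately show ?thesis by blast
  qed
  then obtain f where f: "\<And>l. l \<in> L \<Longrightarrow> f l < n"
      "\<And>l k. l \<in> L \<Longrightarrow> k < 2 * n \<Longrightarrow> A ! k \<subseteq> l \<longleftrightarrow> k mod n = f l"
    by metis
  have "inj_on f L"
  proof (rule inj_onI)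
    fix l l' assume l: "l \<in> L" "l' \<in> L" "f l = f l'"
    have i: "f l < 2 * n" "f l + n < 2 * n" "f l < n" using f(1)[OF l(1)] by auto
    show "l = l'"
    proof (rule proj_line_unique)
      show "A ! f l \<in> proj_points" "A ! (f l + n) \<in> proj_points" using i A nth_mem by fastforce+
      show "A ! f l \<noteq> A ! (f l + n)" using i A by (simp add: nth_eq_iff_index_eq)
      show "A ! f l \<subseteq> l" "A ! (f l + n) \<subseteq> l" "A ! f l \<subseteq> l'" "A ! (f l + n) \<subseteq> l'"
        using f(2)[OF l(1)] f(2)[OF l(2)] l(3) i by auto
    qed (use l assms(3) in auto)
  qed
  then have "f ` L = {..<n}"
    using f(1) assms(4,5) by (intro card_subset_eq) (auto simp: card_image)
  then have bij: "bij_betw f L {..<n}" using \<open>inj_on f L\<close> by (simp add: bij_betw_def)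
  show ?thesis
  proof (rule that[of "inv_into L f"])
    show "inv_into L f ` {..<n} = L"
      using bij_betw_inv_into[OF bij] by (simp add: bij_betw_def)
    show "A ! k \<subseteq> inv_into L f i \<longleftrightarrow> k mod n = i" if "i < n" "k < 2 * n" for i k
      using f(2)[of "inv_into L f i" k] that \<open>f ` L = {..<n}\<close> inv_into_into[of i f L]
        f_inv_into_f[of i f L] by simp
  qed
qed

lemma labelling_well_inscribed:
  assumes "length A = 2 * n" "distinct A" "l ` {..<n} = L"
    and on: "\<And>i k. i < n \<Longrightarrow> k < 2 * n \<Longrightarrow> A ! k \<subseteq> l i \<longleftrightarrow> k mod n = i"
  shows "well_inscribed L A"
proof -
  have "card {v \<in> set A. v \<subseteq> l i} = 2" if i: "i < n" for i
  proof -
    have "{v \<in> set A. v \<subseteq> l i} = {A ! i, A ! (i + n)}"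
    proof
      show "{v \<in> set A. v \<subseteq> l i} \<subseteq> {A ! i, A ! (i + n)}"
      proof
        fix v assume "v \<in> {v \<in> set A. v \<subseteq> l i}"
        then obtain k where "k < 2 * n" "v = A ! k" "A ! k \<subseteq> l i"
          using assms(1) by (auto simp: in_set_conv_nth)
        then show "v \<in> {A ! i, A ! (i + n)}" using on[OF i] mod_eq_iff_half[of k n i] i by auto
      qed
      show "{A ! i, A ! (i + n)} \<subseteq> {v \<in> set A. v \<subseteq> l i}"
        using on[OF i, of i] on[OF i, of "i + n"] i assms(1) by auto
    qed
    moreover have "A ! i \<noteq> A ! (i + n)" using i assms(1,2) by (simp add: nth_eq_iff_index_eq)
    ultimately show ?thesis by simp
  qed
  moreover have "k = j + n" if "i < n" "j < k" "k < 2 * n" "A ! j \<subseteq> l i" "A ! k \<subseteq> l i" for i j k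
    using on[OF that(1), of j] on[OF that(1), of k] that mod_eq_iff_half[of j n i]
      mod_eq_iff_half[of k n i] by auto
  ultimately show ?thesis
    unfolding well_inscribed_def exactly_two_vertices_def on_opposite_vertices_def
      assms(3)[symmetric] using assms(1) by auto
qed

lemma infinite_points_on_line:
  assumes "l \<in> proj_lines" shows "infinite {p \<in> proj_points. p \<subseteq> l}"
proof -
  obtain u v where uv: "u \<noteq> 0" "v \<notin> pt u" "l = vec.span {u, v}"
    using proj_line_cases[OF assms] .
  define f where "f t = t *s u + 1 *s v" for t
  have nz: "f t \<noteq> 0" for t
  proof
    assume "f t = 0"
    then have "v = (- t) *s u" by (simp add: f_def eq_neg_iff_add_eq_0 add.commute)
    then show False using uv(2) in_pt_iff by blast
  qed
  have "inj (\<lambda>t. pt (f t))"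
  proof (rule injI)
    fix s t assume "pt (f s) = pt (f t)"
    then have "f s \<in> pt (f t)" using self_in_pt by metis
    then obtain c where c: "f s = c *s f t" using in_pt_iff by blast
    then have e: "(1 - c) *s v = (c * t - s) *s u"
      unfolding f_def by (simp add: vec_eq_iff algebra_simps)
    have "c = 1"
    proof (rule ccontr)
      assume "c \<noteq> 1"
      then have "v = (1 / (1 - c)) *s ((1 - c) *s v)"
        unfolding vector_smult_assoc by simp
      also have "\<dots> = ((c * t - s) / (1 - c)) *s u" unfolding e vector_smult_assoc by simp
      finally show False using uv(2) in_pt_iff by blast
    qed
    then have "(t - s) *s u = 0" using e by simp
    then show "s = t" using uv(1) by simp
  qed
  then have "infinite (range (\<lambda>t. pt (f t)))"
    using finite_imageD infinite_UNIV_char_0 by blast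
  moreover have "range (\<lambda>t. pt (f t)) \<subseteq> {p \<in> proj_points. p \<subseteq> l}"
  proof -
    have "f t \<in> l" for t unfolding f_def using uv(3) in_span_pair_iff by blast
    moreover have "vec.subspace l" using assms by (simp add: proj_lines_def)
    ultimately show ?thesis using proj_point_pt[OF nz] subset_iff_pt by blast
  qed
  ultimately show ?thesis using finite_subset by blast
qed

context polarity begin

section \<open>Circumscribed polygons as chains of tangency points\<close>

lemma orthogonal_isotropic_triple:
  assumes "isotropic x" "isotropic y" "isotropic z" "y \<notin> pt x" "z \<notin> pt x" "z \<notin> pt y"
    and "B x a = 0" "B y a = 0" "B z a = 0"
  shows "a = 0"
proof -
  have "x \<noteq> 0" using assms(1) by (simp add: isotropic_def)
  then show ?thesis
    using orthogonal_to_triple[OF _ assms(4) isotropic_not_in_span[OF assms(1-6)], of a] assms(7-9)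
    by (simp add: sym[of a])
qed

text \<open>
  Distinct tangents suffice for the intersections of consecutive ones to form a nondegenerate
  polygon: no three tangents to a conic are concurrent, so no vertex is repeated. The index \<open>k\<close> of
  a vertex is that of the tangent before it.
\<close>

lemma tangential_polygon:
  assumes m: "m \<ge> 3" and iso: "\<And>k. isotropic (y k)" and per: "\<And>k. y (k + m) = y k"
    and ne: "\<And>i j. i < m \<Longrightarrow> j < m \<Longrightarrow> i \<noteq> j \<Longrightarrow> y j \<notin> pt (y i)"
    and len: "length A = m" and A: "\<And>k. k < m \<Longrightarrow> A ! k = perp (y k) \<inter> perp (y (Suc k))"
  shows "polygon m A" "\<And>k. k < m \<Longrightarrow> sides A ! k = perp (y (Suc k))"
proof -
  have y_mod: "y (k mod m) = y k" for k by (rule periodic_mod[of y m, OF per])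
  have ne': "y j \<notin> pt (y i)" if "i mod m \<noteq> j mod m" for i j
    by (rule periodic_noncoincident[of m y, OF _ per ne that]) (use m in auto)
  have nz: "y k \<noteq> 0" for k using iso by (simp add: isotropic_def)
  have Suc_ne: "k mod m \<noteq> Suc k mod m" "k mod m \<noteq> Suc (Suc k) mod m" for k
    using m by (auto simp: mod_Suc split: if_splits)
  have "\<exists>a. a \<noteq> 0 \<and> A ! k = pt a" if "k < m" for k
    using exists_vertex[OF nz ne'[OF Suc_ne(1)[of k]]] A[OF that] by metis
  then obtain a where a: "\<And>k. k < m \<Longrightarrow> a k \<noteq> 0" "\<And>k. k < m \<Longrightarrow> A ! k = pt (a k)" by metis
  have orth: "B (y k) (a k) = 0 \<and> B (y (Suc k)) (a k) = 0" if "k < m" for k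
    using a(2)[OF that] A[OF that] self_in_pt[of "a k"] by (auto simp: in_perp_iff)
  have neq: "A ! j \<noteq> A ! k" if "j < k" "k < m" for j k
  proof
    assume eq: "A ! j = A ! k"
    have "a j \<in> perp (y k) \<inter> perp (y (Suc k))" using eq a(2)[of j] A[of k] that self_in_pt by auto
    then have o: "B (y j) (a j) = 0" "B (y (Suc j)) (a j) = 0" "B (y k) (a j) = 0"
        "B (y (Suc k)) (a j) = 0"
      using orth[of j] that by (auto simp: in_perp_iff)
    have "a j = 0"
    proof (cases "k = Suc j")
      case True
      show ?thesis
        by (rule orthogonal_isotropic_triple[OF iso[of j] iso[of "Suc j"] iso[of "Suc (Suc j)"]])
          (use o True ne' Suc_ne in auto)
    next
      case False
      show ?thesis
        by (rule orthogonal_isotropic_triple[OF iso[of j] iso[of "Suc j"] iso[of k]])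
          (use o False that ne in auto)
    qed
    then show False using a(1)[of j] that by simp
  qed
  have dist: "distinct A" unfolding distinct_conv_nth len using neq by (metis nat_neq_iff)
  show side: "sides A ! k = perp (y (Suc k))" if k: "k < m" for k
  proof -
    let ?k = "Suc k mod m"
    have k': "?k < m" using m by simp
    have "A ! k \<noteq> A ! ?k" using dist k k' len Suc_ne(1)[of k] by (simp add: nth_eq_iff_index_eq)
    then have n: "a ?k \<notin> pt (a k)" using pt_eq a k k' by metis
    have "sides A ! k = line_through (pt (a k)) (pt (a ?k))"
      using k k' a(2) len by (simp add: sides_def)
    also have "\<dots> = vec.span {a k, a ?k}" using line_through_pts n a(1) k by blast
    also have "\<dots> = perp (y (Suc k))"
    proof (rule proj_line_eq_span_pair[symmetric])
      show "perp (y (Suc k)) \<in> proj_lines" using proj_line_perp nz by blast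
      show "a k \<in> perp (y (Suc k))" using orth[OF k] by (simp add: in_perp_iff)
      show "a ?k \<in> perp (y (Suc k))" using orth[OF k'] y_mod[of "Suc k"] by (simp add: in_perp_iff)
    qed (use n a(1) k in auto)
    finally show ?thesis .
  qed
  have len': "length (sides A) = m" by (simp add: sides_def len)
  have "distinct (sides A)"
    unfolding distinct_conv_nth len'
  proof (intro allI impI)
    fix i j assume ij: "i < m" "j < m" "i \<noteq> j"
    have "Suc i mod m \<noteq> Suc j mod m" using ij m by (auto simp: mod_Suc)
    then have "B (y (Suc i)) (y (Suc j)) \<noteq> 0" using isotropic_pairing iso ne' by blast
    then have "y (Suc j) \<notin> perp (y (Suc i))" by (simp add: in_perp_iff)
    moreover have "y (Suc j) \<in> perp (y (Suc j))" using iso by (simp add: in_perp_iff isotropic_def)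
    ultimately show "sides A ! i \<noteq> sides A ! j" using side ij by auto
  qed
  moreover have "set A \<subseteq> proj_points"
    using a len proj_point_pt by (auto simp: in_set_conv_nth)
  ultimately show "polygon m A" unfolding polygon_def using dist len by blast
qed

text \<open>
  Conversely, a circumscribed polygon gives its periodic sequence of tangency points. The side
  that follows vertex \<open>k\<close> touches the conic at \<open>y (Suc k)\<close>, whence the shift \<open>p\<close> in the proof.
\<close>

lemma polygon_tangency_points:
  assumes poly: "polygon m A" and m: "m \<ge> 2"
    and tang: "\<And>s. s \<in> set (sides A) \<Longrightarrow> \<exists>x. isotropic x \<and> s = perp x"
  obtains y where "\<And>k. isotropic (y k)" "\<And>k. y (k + m) = y k"
    "\<And>i j. i < m \<Longrightarrow> j < m \<Longrightarrow> i \<noteq> j \<Longrightarrow> y j \<notin> pt (y i)"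
    "\<And>k. k < m \<Longrightarrow> A ! k = perp (y k) \<inter> perp (y (Suc k))"
proof -
  have P: "length A = m" "set A \<subseteq> proj_points" "distinct A" "distinct (sides A)"
    using poly by (auto simp: polygon_def)
  have len': "length (sides A) = m" by (simp add: sides_def P)
  have "\<exists>x. isotropic x \<and> sides A ! k = perp x" if "k < m" for k
    using tang that len' nth_mem by metis
  then obtain x where x: "\<And>k. k < m \<Longrightarrow> isotropic (x k)" "\<And>k. k < m \<Longrightarrow> sides A ! k = perp (x k)"
    by metis
  define p where "p k = (k + m - 1) mod m" for k
  define y where "y k = x (p k)" for k
  have p: "p k < m" for k using m by (simp add: p_def)
  have iso: "isotropic (y k)" for k using x(1) p by (simp add: y_def)
  have pS: "p (Suc k) = k mod m" for k using m by (simp add: p_def)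
  have Sp: "Suc (p k) mod m = k mod m" for k
  proof -
    have "Suc (p k) mod m = Suc (k + m - 1) mod m" unfolding p_def by (rule mod_Suc_eq)
    then show ?thesis using m by simp
  qed
  have "p (k + m) = p k" for k
  proof -
    have "k + m + m - 1 = (k + m - 1) + m" using m by simp
    then show ?thesis unfolding p_def by (metis mod_add_self2)
  qed
  then have per: "y (k + m) = y k" for k by (simp add: y_def)
  have ne: "y j \<notin> pt (y i)" if "i mod m \<noteq> j mod m" for i j
  proof
    assume "y j \<in> pt (y i)"
    then have "pt (y j) = pt (y i)" using pt_eq iso by (auto simp: isotropic_def)
    then have "sides A ! p i = sides A ! p j" using perp_cong x(2) p by (metis y_def)
    then have "p i = p j" using P(4) p len' nth_eq_iff_index_eq by metis
    then show False using Sp that by metis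
  qed
  have "A ! k = perp (y k) \<inter> perp (y (Suc k))" if k: "k < m" for k
  proof -
    obtain a where a: "a \<noteq> 0" "A ! k = pt a"
      using proj_point_cases[of "A ! k"] P k nth_mem by blast
    have side: "sides A ! j = vec.span (A ! j \<union> A ! (Suc j mod m))" if "j < m" for j
      using that P(1) by (simp add: sides_def line_through_def)
    have "pt a \<subseteq> sides A ! k"
      using side[OF k] a vec.span_superset by (metis Un_subset_iff)
    then have 1: "B (y (Suc k)) a = 0" using x(2)[OF k] pS[of k] k pt_subset_perp by (simp add: y_def)
    have "pt a \<subseteq> sides A ! p k"
      using side[OF p] Sp[of k] k a vec.span_superset by (metis Un_subset_iff mod_less)
    then have 2: "B (y k) a = 0" using x(2)[OF p] pt_subset_perp by (simp add: y_def)
    have "Suc k mod m \<noteq> k mod m" using m by (auto simp: mod_Suc)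
    then have "y (Suc k) \<notin> pt (y k)" using ne by metis
    then show ?thesis using perp_pair_eq_pt[OF _ _ a(1) 2 1] iso[of k] a(2) by (auto simp: isotropic_def)
  qed
  then show ?thesis using that[of y] iso per ne by simp
qed


section \<open>Generic chains\<close>

text \<open>
  The sides of the polygon that starts from \<open>x\<close> are distinct, and its vertices lie on no further
  lines of the configuration. The second condition is written through reflections so that both
  conditions say that two isometries differ at \<open>x\<close>.
\<close>

definition generic :: "(nat \<Rightarrow> complex^3) \<Rightarrow> nat \<Rightarrow> complex^3 \<Rightarrow> bool" where
  "generic q n x \<longleftrightarrow>
     (\<forall>i<2*n. \<forall>j<2*n. i \<noteq> j \<longrightarrow> reflections q j x \<notin> pt (reflections q i x)) \<and>
     (\<forall>i<n. \<forall>k<2*n. k mod n \<noteq> i \<longrightarrow>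
        reflect (q i) (reflections q k x) \<notin> pt (reflections q (Suc k) x))"

text \<open>
  A single generic point shows that each pair of isometries in the definition differs somewhere;
  so each pair agrees at only finitely many points of the conic.
\<close>

lemma finite_not_generic:
  assumes q: "\<And>k. B (q k) (q k) \<noteq> 0" and w: "generic q n w"
  shows "finite {pt x | x. isotropic x \<and> \<not> generic q n x}"
proof -
  define E where "E M N = {pt x | x. isotropic x \<and> M x \<in> pt (N x)}" for M N
  let ?G = "reflections q"
  have G: "isometry (?G k)" for k by (rule isometry_reflections[OF q])
  have RG: "isometry (\<lambda>x. reflect (q i) (?G k x))" for i k
    by (rule isometry_compose[OF isometry_reflect[OF q] G])
  have "finite (E (?G j) (?G i))" if "i < 2 * n" "j < 2 * n" "i \<noteq> j" for i j
    unfolding E_def using w that unfolding generic_def by (intro finite_agreement[OF G G, of _ w]) blast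
  then have 1: "finite (\<Union>i<2*n. \<Union>j<2*n. if i \<noteq> j then E (?G j) (?G i) else {})" by auto
  have "finite (E (\<lambda>x. reflect (q i) (?G k x)) (?G (Suc k)))"
    if "i < n" "k < 2 * n" "k mod n \<noteq> i" for i k
    unfolding E_def using w that unfolding generic_def by (intro finite_agreement[OF RG G, of _ _ w]) blast
  then have 2: "finite (\<Union>i<n. \<Union>k<2*n.
      if k mod n \<noteq> i then E (\<lambda>x. reflect (q i) (?G k x)) (?G (Suc k)) else {})" by auto
  have "pt x \<in> (\<Union>i<2*n. \<Union>j<2*n. if i \<noteq> j then E (?G j) (?G i) else {}) \<union>
      (\<Union>i<n. \<Union>k<2*n. if k mod n \<noteq> i then E (\<lambda>x. reflect (q i) (?G k x)) (?G (Suc k)) else {})"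
    if x: "isotropic x" "\<not> generic q n x" for x
  proof -
    have E: "pt x \<in> E M N" if "M x \<in> pt (N x)" for M N using x(1) that unfolding E_def by blast
    consider i j where "i < 2 * n" "j < 2 * n" "i \<noteq> j" "?G j x \<in> pt (?G i x)"
      | i k where "i < n" "k < 2 * n" "k mod n \<noteq> i" "reflect (q i) (?G k x) \<in> pt (?G (Suc k) x)"
      using x(2) unfolding generic_def by blast
    then show ?thesis
    proof cases
      case 1
      then have "pt x \<in> (if i \<noteq> j then E (?G j) (?G i) else {})" using E by simp
      then show ?thesis using 1 by blast
    next
      case 2
      have "pt x \<in> E (\<lambda>x. reflect (q i) (?G k x)) (?G (Suc k))" by (rule E) (rule 2)
      then have "pt x \<in> (if k mod n \<noteq> i then E (\<lambda>x. reflect (q i) (?G k x)) (?G (Suc k)) else {})"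
        unfolding if_P[OF 2(3)] .
      then show ?thesis using 2(1,2) by blast
    qed
  qed
  then show ?thesis using 1 2 by (intro finite_subset[OF _ finite_UnI[OF 1 2]]) blast
qed

lemma generic_chain_polygon:
  assumes n: "n \<ge> 2" and q: "\<And>k. B (q k) (q k) \<noteq> 0" "\<And>k. q (k + n) = q k"
    and closes: "\<And>k v. reflections q (k + 2 * n) v = reflections q k v"
    and x: "isotropic x" "generic q n x"
    and A: "A = map (\<lambda>k. perp (reflections q k x) \<inter> perp (reflections q (Suc k) x)) [0..<2*n]"
    and L: "(\<lambda>i. perp (q i)) ` {..<n} = L"
  shows "polygon (2 * n) A" "well_inscribed L A"
    "\<And>s. s \<in> set (sides A) \<Longrightarrow> \<exists>z. isotropic z \<and> s = perp z"
proof -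
  let ?y = "\<lambda>k. reflections q k x"
  have iso: "isotropic (?y k)" for k
    unfolding isotropic_reflections_iff[of q, OF q(1)] by (rule x(1))
  have ne: "?y j \<notin> pt (?y i)" if "i < 2 * n" "j < 2 * n" "i \<noteq> j" for i j
    using x(2) that unfolding generic_def by blast
  have len: "length A = 2 * n" by (simp add: A)
  have nth: "A ! k = perp (?y k) \<inter> perp (?y (Suc k))" if "k < 2 * n" for k
    using that by (simp add: A del: reflections.simps)
  have m: "3 \<le> 2 * n" using n by simp
  show poly: "polygon (2 * n) A"
    by (rule tangential_polygon(1)[of _ ?y, OF m iso closes ne len nth])
  have side: "sides A ! k = perp (?y (Suc k))" if "k < 2 * n" for k
    by (rule tangential_polygon(2)[of _ ?y, OF m iso closes ne len nth that])
  show "\<exists>z. isotropic z \<and> s = perp z" if s: "s \<in> set (sides A)" for s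
  proof -
    have "length (sides A) = 2 * n" by (simp add: sides_def len)
    then obtain k where "k < 2 * n" "s = sides A ! k"
      using s unfolding in_set_conv_nth by auto
    then show ?thesis using side[of k] iso[of "Suc k"] by blast
  qed
  have q_mod: "q (k mod n) = q k" for k by (rule periodic_mod[of q n, OF q(2)])
  show "well_inscribed L A"
  proof (rule labelling_well_inscribed[OF len _ L])
    show "distinct A" using poly by (simp add: polygon_def)
    fix i k assume ik: "i < n" "k < 2 * n"
    have "?y (Suc k) \<notin> pt (?y k)"
      by (rule periodic_noncoincident[of "2 * n" ?y, OF _ closes ne Suc_mod_neq]) (use n in auto)
    then have "A ! k \<subseteq> perp (q i) \<longleftrightarrow> reflect (q i) (?y k) \<in> pt (?y (Suc k))"
      unfolding nth[OF ik(2)] by (rule vertex_on_line_iff[OF iso iso _ q(1)])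
    also have "\<dots> \<longleftrightarrow> k mod n = i"
    proof
      assume "reflect (q i) (?y k) \<in> pt (?y (Suc k))"
      then show "k mod n = i" using x(2) ik unfolding generic_def by blast
    next
      assume "k mod n = i"
      then have "reflect (q i) (?y k) = ?y (Suc k)" using q_mod[of k] by simp
      then show "reflect (q i) (?y k) \<in> pt (?y (Suc k))" by (metis self_in_pt)
    qed
    finally show "A ! k \<subseteq> perp (q i) \<longleftrightarrow> k mod n = i" .
  qed
qed

text \<open>
  The given polygon supplies both the closing of all chains and the point at which the pairs of
  isometries in \<open>generic\<close> differ.
\<close>

lemma polygon_generic:
  assumes n: "n \<ge> 2" and q: "\<And>k. B (q k) (q k) \<noteq> 0" "\<And>k. q (k + n) = q k"
    and poly: "polygon (2 * n) A"
    and tang: "\<And>s. s \<in> set (sides A) \<Longrightarrow> \<exists>x. isotropic x \<and> s = perp x"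
    and on: "\<And>i k. i < n \<Longrightarrow> k < 2 * n \<Longrightarrow> A ! k \<subseteq> perp (q i) \<longleftrightarrow> k mod n = i"
  obtains w where "generic q n w" "\<And>k v. reflections q (k + 2 * n) v = reflections q k v"
proof -
  have m: "2 \<le> 2 * n" using n by simp
  obtain y where iso: "\<And>k. isotropic (y k)" and per: "\<And>k. y (k + 2 * n) = y k"
    and ne: "\<And>i j. i < 2 * n \<Longrightarrow> j < 2 * n \<Longrightarrow> i \<noteq> j \<Longrightarrow> y j \<notin> pt (y i)"
    and nth: "\<And>k. k < 2 * n \<Longrightarrow> A ! k = perp (y k) \<inter> perp (y (Suc k))"
    using polygon_tangency_points[OF poly m tang] by blast
  have nz: "y k \<noteq> 0" for k using iso by (simp add: isotropic_def)
  have vertex: "A ! k \<subseteq> perp (q i) \<longleftrightarrow> reflect (q i) (y k) \<in> pt (y (Suc k))" if k: "k < 2 * n" for i k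
  proof -
    have "y (Suc k) \<notin> pt (y k)"
      by (rule periodic_noncoincident[of "2 * n" y, OF _ per ne Suc_mod_neq]) (use n in auto)
    then show ?thesis unfolding nth[OF k] by (rule vertex_on_line_iff[OF iso iso _ q(1)])
  qed
  have step: "reflect (q k) (y k) \<in> pt (y (Suc k))" for k
  proof -
    define r where "r = k mod (2 * n)"
    have r: "r < 2 * n" "r mod n < n" using n by (simp_all add: r_def)
    have "q (k + 2 * n) = q k" for k using q(2)[of "k + n"] q(2)[of k] by (simp add: mult_2 add.assoc)
    then have "q r = q k" unfolding r_def by (rule periodic_mod[of q])
    moreover have "y r = y k" unfolding r_def by (rule periodic_mod[of y, OF per])
    moreover have "y (Suc r) = y (Suc k)"
      unfolding r_def
      by (rule periodic_mod[of "\<lambda>k. y (Suc k)"]) (use per[of "Suc k" for k] in simp)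
    moreover have "q (r mod n) = q r" by (rule periodic_mod[of q n, OF q(2)])
    ultimately show ?thesis using on[OF r(2,1)] vertex[OF r(1), of "r mod n"] by simp
  qed
  have closes: "reflections q (k + 2 * n) v = reflections q k v" for k v
    by (rule chain_closes[of q n y, OF q iso _ _ step]) (use per[of 0] ne[of 0 n] n in \<open>auto simp: mult_2\<close>)
  have orbit: "reflections q k (y 0) \<in> pt (y k)" for k
    using chain_orbit[of q 0 y, OF q(1) _ step, of k] by simp
  have "reflections q k (y 0) \<noteq> 0" for k
    unfolding isometry_eq_0_iff[OF isometry_reflections[of q, OF q(1)]] by (rule nz)
  then have orbit': "pt (reflections q k (y 0)) = pt (y k)" for k using pt_eq orbit by blast
  have "generic q n (y 0)"
    unfolding generic_def
  proof (intro conjI allI impI)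
    fix i j assume ij: "i < 2 * n" "j < 2 * n" "i \<noteq> j"
    show "reflections q j (y 0) \<notin> pt (reflections q i (y 0))"
    proof
      assume "reflections q j (y 0) \<in> pt (reflections q i (y 0))"
      then have "pt (y j) \<subseteq> pt (y i)"
        unfolding orbit'[symmetric] using subset_iff_pt[OF vec.subspace_span] by blast
      then show False using ne[OF ij] self_in_pt by blast
    qed
  next
    fix i k assume ik: "i < n" "k < 2 * n" "k mod n \<noteq> i"
    show "reflect (q i) (reflections q k (y 0)) \<notin> pt (reflections q (Suc k) (y 0))"
    proof
      assume "reflect (q i) (reflections q k (y 0)) \<in> pt (reflections q (Suc k) (y 0))"
      then have 1: "pt (reflect (q i) (reflections q k (y 0))) \<subseteq> pt (y (Suc k))"
        unfolding orbit' using subset_iff_pt[OF vec.subspace_span] by blast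
      have "y k \<in> pt (reflections q k (y 0))" unfolding orbit' by simp
      then have "reflect (q i) (y k) \<in> pt (reflect (q i) (reflections q k (y 0)))"
        by (rule isometry_in_pt[OF isometry_reflect[OF q(1)]])
      then have "A ! k \<subseteq> perp (q i)" using 1 vertex[OF ik(2)] by blast
      then show False using on ik by blast
    qed
  qed
  then show ?thesis using that closes by blast
qed

text \<open>
  Choose a tangent to the conic through the given point and trace the chain back from its point of
  tangency. The second conclusion determines the given point by \<open>x\<close> and \<open>i\<close>, so that finitely many
  \<open>x\<close> account for finitely many points of the lines.
\<close>

lemma chain_through_point:
  assumes q: "\<And>k. B (q k) (q k) \<noteq> 0" and a: "a \<noteq> 0" "B (q i) a = 0"
  obtains x where "isotropic x" "pt a = perp (reflections q i x) \<inter> perp (q i)"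
    "B (reflections q (Suc i) x) a = 0"
proof -
  obtain z where z: "isotropic z" "z \<in> perp a"
    using line_meets_conic[OF proj_line_perp[OF a(1)]] by blast
  have za: "B z a = 0" using z(2) sym by (simp add: in_perp_iff)
  obtain x where x: "reflections q i x = z" using surj_reflections[of q, OF q] by blast
  have qz: "q i \<noteq> 0" using q[of i] by auto
  have "q i \<notin> pt z" using isotropic_scale[OF z(1) _ qz] q by (auto simp: isotropic_def)
  then have "perp z \<inter> perp (q i) = pt a"
    using perp_pair_eq_pt[OF _ _ a(1) za a(2)] z(1) by (auto simp: isotropic_def)
  moreover have "isotropic x"
    using z(1) unfolding x[symmetric] isotropic_reflections_iff[of q, OF q] .
  moreover have "B (reflections q (Suc i) x) a = 0"
    using x za a(2) by (simp add: reflect_def bilinear)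
  ultimately show ?thesis using that x by blast
qed

lemma generic_points_are_vertices:
  assumes n: "n \<ge> 2" and q: "\<And>k. B (q k) (q k) \<noteq> 0" "\<And>k. q (k + n) = q k"
    and L: "(\<lambda>i. perp (q i)) ` {..<n} = L"
    and w: "generic q n w" and closes: "\<And>k v. reflections q (k + 2 * n) v = reflections q k v"
  shows "finite {p \<in> points_of L. \<not> (\<exists>A. polygon (2 * n) A \<and> well_inscribed L A \<and>
      (\<forall>s\<in>set (sides A). \<exists>z. isotropic z \<and> s = perp z) \<and> p \<in> set A)}" (is "finite ?X")
proof -
  let ?bad = "{pt x | x. isotropic x \<and> \<not> generic q n x}"
  \<comment> \<open>the point of line \<open>i\<close> determined by a chain, as a function of the conic point \<open>P\<close> that
    starts it and not of a representing vector\<close>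
  define V where "V i P = {v. \<forall>x\<in>P. B (reflections q i x) v = 0} \<inter> perp (q i)" for i P
  have V: "V i (pt x) = perp (reflections q i x) \<inter> perp (q i)" for i x
  proof -
    have "B (reflections q i (c *s x)) v = c * B (reflections q i x) v" for c v
      unfolding isometry_scale[OF isometry_reflections[of q i, OF q(1)]] scale_left ..
    then have "(\<forall>z\<in>pt x. B (reflections q i z) v = 0) \<longleftrightarrow> B (reflections q i x) v = 0" for v
      using in_pt_iff[of _ x] self_in_pt[of x] by (metis mult_zero_right)
    then show ?thesis unfolding V_def perp_def by simp
  qed
  have "?X \<subseteq> (\<Union>i<n. V i ` ?bad)"
  proof
    fix p assume p: "p \<in> ?X"
    then have "p \<in> proj_points" "\<exists>i<n. p \<subseteq> perp (q i)"
      unfolding points_of_def L[symmetric] by auto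
    then obtain i a where i: "i < n" "p \<subseteq> perp (q i)" and a: "a \<noteq> 0" "p = pt a"
      using proj_point_cases by metis
    have qa: "B (q i) a = 0" using i(2) a(2) pt_subset_perp by simp
    obtain x where x: "isotropic x" "pt a = perp (reflections q i x) \<inter> perp (q i)"
        "B (reflections q (Suc i) x) a = 0"
      by (rule chain_through_point[of q, OF q(1) a(1) qa])
    have "\<not> generic q n x"
    proof
      assume g: "generic q n x"
      define A where
        "A = map (\<lambda>k. perp (reflections q k x) \<inter> perp (reflections q (Suc k) x)) [0..<2*n]"
      note P = generic_chain_polygon[OF n q closes x(1) g A_def L]
      have "isotropic (reflections q i x)"
        unfolding isotropic_reflections_iff[of q, OF q(1)] by (rule x(1))
      then have nz: "reflections q i x \<noteq> 0" by (simp add: isotropic_def)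
      have "reflections q (Suc i) x \<notin> pt (reflections q i x)"
      proof -
        have "i < 2 * n" "Suc i < 2 * n" "i \<noteq> Suc i" using i(1) n by simp_all
        then show ?thesis using g unfolding generic_def by blast
      qed
      moreover have "B (reflections q i x) a = 0"
        using x(2) self_in_pt[of a] unfolding in_perp_iff[symmetric] by blast
      ultimately have "perp (reflections q i x) \<inter> perp (reflections q (Suc i) x) = pt a"
        using perp_pair_eq_pt[OF nz _ a(1) _ x(3)] by blast
      then have "A ! i = p" using i(1) a(2) by (simp add: A_def del: reflections.simps)
      moreover have "A ! i \<in> set A" using i(1) by (intro nth_mem) (simp add: A_def)
      ultimately have "p \<in> set A" by simp
      moreover have "\<forall>s\<in>set (sides A). \<exists>z. isotropic z \<and> s = perp z" using P(3) by (rule ballI)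
      ultimately show False using p P(1,2) by blast
    qed
    then have "pt x \<in> ?bad" using x(1) by (intro CollectI exI[of _ x]) simp
    then have "V i (pt x) \<in> V i ` ?bad" by (rule imageI)
    moreover have "p = V i (pt x)" using V x(2) a(2) by (simp only:)
    moreover have "i \<in> {..<n}" using i(1) by simp
    ultimately show "p \<in> (\<Union>i<n. V i ` ?bad)" by (intro UN_I) simp_all
  qed
  moreover have "finite ?bad" by (rule finite_not_generic[of q, OF q(1) w])
  then have "finite (\<Union>i<n. V i ` ?bad)" by (intro finite_UN_I finite_imageI) simp_all
  ultimately show ?thesis by (rule finite_subset)
qed

end

section \<open>Smooth conics\<close>

text \<open>
  The partial derivatives at \<open>x\<close> are, up to the factor 2, the coordinates of \<open>B x\<close>. A vector in the
  radical of \<open>B\<close> is therefore a singular point of the conic, which is excluded unless it is 0.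
\<close>

lemma smooth_conic_polarity:
  assumes "smooth_conic F"
  obtains B where "polarity B" "\<And>x. F x = B x x"
    "\<And>x i. partial_deriv F i x = 2 * B x (axis i 1)"
proof -
  obtain M :: "complex^3^3" where M: "\<And>x. F x = (\<Sum>i\<in>UNIV. \<Sum>j\<in>UNIV. M $ i $ j * x $ i * x $ j)"
    using assms by (auto simp: smooth_conic_def quadratic_form_def)
  define B :: "complex^3 \<Rightarrow> complex^3 \<Rightarrow> complex"
    where "B x y = (\<Sum>i\<in>UNIV. \<Sum>j\<in>UNIV. (M $ i $ j + M $ j $ i) / 2 * x $ i * y $ j)" for x y
  have F: "F x = B x x" for x
    unfolding M B_def sum_3 by (simp add: field_simps)
  have sym: "B x y = B y x" for x y
    unfolding B_def sum_3 by (simp add: field_simps)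
  have add: "B (x + y) z = B x z + B y z" and scale: "B (c *s x) z = c * B x z" for x y z c
    unfolding B_def sum_3 by (simp_all add: field_simps)
  have add': "B z (x + y) = B z x + B z y" and scale': "B z (c *s x) = c * B z x" for x y z c
    using add scale sym by metis+
  have pd: "partial_deriv F i x = 2 * B x (axis i 1)" for x i
  proof -
    let ?e = "axis i 1 :: complex^3"
    have "F (x + t *s ?e) = B x x + 2 * t * B x ?e + t * t * B ?e ?e" for t
      by (simp add: F add scale add' scale' sym[of ?e x] algebra_simps)
    then show ?thesis unfolding partial_deriv_def
      by (auto intro!: DERIV_imp_deriv derivative_eq_intros)
  qed
  have "x = 0" if "\<And>y. B x y = 0" for x
    using assms that F pd unfolding smooth_conic_def by auto
  then have "polarity B" using sym add scale by unfold_locales auto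
  then show ?thesis using that F pd by blast
qed

lemma (in polarity) conic_and_tangents:
  assumes F: "\<And>x. F x = B x x" and pd: "\<And>x i. partial_deriv F i x = 2 * B x (axis i 1)"
  shows "conic F = {pt x | x. isotropic x}" "tangent_to F s \<longleftrightarrow> (\<exists>x. isotropic x \<and> s = perp x)"
proof -
  have pt: "(\<forall>y\<in>pt x. F y = 0) \<longleftrightarrow> B x x = 0" for x
    using in_pt_iff[of _ x] self_in_pt[of x] by (auto simp: F bilinear)
  show conic: "conic F = {pt x | x. isotropic x}"
    unfolding conic_def isotropic_def using pt proj_point_pt proj_point_cases by (auto; metis)
  have grad: "(\<Sum>i\<in>UNIV. partial_deriv F i x * y $ i) = 2 * B x y" for x y
  proof -
    have "y = (\<Sum>i\<in>UNIV. (y $ i) *s axis i 1)" by (rule basis_expansion[symmetric])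
    then have "B x y = B x (\<Sum>i\<in>UNIV. (y $ i) *s axis i 1)" by simp
    then show ?thesis by (simp add: pd sum_3 bilinear algebra_simps)
  qed
  have "tangent_line F (pt x) = perp x" for x
  proof -
    have "(\<forall>z\<in>pt x. B z y = 0) \<longleftrightarrow> B x y = 0" for y
      using in_pt_iff[of _ x] self_in_pt[of x] by (auto simp: bilinear)
    then show ?thesis by (simp add: tangent_line_def grad perp_def)
  qed
  then show "tangent_to F s \<longleftrightarrow> (\<exists>x. isotropic x \<and> s = perp x)"
    unfolding tangent_to_def conic by (auto; metis)
qed

text \<open>The two sides of a 2-gon would be the same line.\<close>

lemma polygon_at_least_4:
  assumes "polygon (2 * n) A" "n \<ge> 1" shows "n \<ge> 2"
proof (rule ccontr)
  assume "\<not> n \<ge> 2"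
  then have "length A = 2" "distinct (sides A)" using assms by (auto simp: polygon_def)
  moreover from this have "sides A ! 0 = sides A ! 1"
    by (simp add: sides_def line_through_def Un_commute)
  moreover have "length (sides A) = 2" using \<open>length A = 2\<close> by (simp add: sides_def)
  ultimately show False using nth_eq_iff_index_eq[of "sides A" 0 1] by simp
qed

section \<open>The Poncelet property\<close>

theorem theorem3p1:
  fixes n :: nat and L :: "subspace3 set" and F :: "complex^3 \<Rightarrow> complex"
  assumes "n \<ge> 1"
    and "L \<subseteq> proj_lines" and "finite L" and "card L = n"
    and "smooth_conic F"
    and "finite (conic F \<inter> points_of L)" and "card (conic F \<inter> points_of L) = 2 * n"
    and "\<exists>A. polygon (2 * n) A \<and> well_inscribed L A \<and> circumscribed F A"
  shows "infinite {A. polygon (2 * n) A \<and> well_inscribed L A \<and> circumscribed F A}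
    \<and> finite {p \<in> points_of L.
        \<not> (\<exists>A. polygon (2 * n) A \<and> well_inscribed L A \<and> circumscribed F A \<and> p \<in> set A)}"
    (is "infinite ?S \<and> finite ?X")
proof -
  obtain B where B: "polarity B" and F: "\<And>x. F x = B x x"
      and pd: "\<And>x i. partial_deriv F i x = 2 * B x (axis i 1)"
    using smooth_conic_polarity[OF assms(5)] by blast
  interpret polarity B by (rule B)
  note conic = conic_and_tangents(1)[OF F pd] and tangent = conic_and_tangents(2)[OF F pd]
  have circ: "circumscribed F A \<longleftrightarrow> (\<forall>s\<in>set (sides A). \<exists>z. isotropic z \<and> s = perp z)" for A
    by (simp add: circumscribed_def tangent)
  obtain A where A: "polygon (2 * n) A" "well_inscribed L A" "circumscribed F A"
    using assms(8) by blast
  have n: "n \<ge> 2" using polygon_at_least_4 A(1) assms(1) .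
  obtain l where l: "l ` {..<n} = L"
      "\<And>i k. i < n \<Longrightarrow> k < 2 * n \<Longrightarrow> A ! k \<subseteq> l i \<longleftrightarrow> k mod n = i"
    using well_inscribed_labelling[OF A(1,2) assms(2-4)] by blast
  have "\<exists>q. q \<noteq> 0 \<and> l i = perp q" if "i < n" for i
    using proj_line_has_pole[of "l i"] that l(1) assms(2) by (metis imageI lessThan_iff subsetD)
  then obtain pole where pole: "\<And>i. i < n \<Longrightarrow> pole i \<noteq> 0" "\<And>i. i < n \<Longrightarrow> l i = perp (pole i)"
    by metis
  define q where "q k = pole (k mod n)" for k
  have L: "(\<lambda>i. perp (q i)) ` {..<n} = L"
    unfolding l(1)[symmetric] by (rule image_cong) (simp_all add: q_def pole)
  have meet: "conic F \<inter> points_of L = {pt x | x. isotropic x \<and> (\<exists>l\<in>L. x \<in> l)}"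
  proof -
    have "pt x \<subseteq> l \<longleftrightarrow> x \<in> l" if "l \<in> L" for l x
      using that assms(2) subset_iff_pt by (auto simp: proj_lines_def)
    moreover have "pt x \<in> proj_points" if "isotropic x" for x
      using that proj_point_pt by (simp add: isotropic_def)
    ultimately show ?thesis unfolding conic points_of_def by auto
  qed
  have q: "B (q k) (q k) \<noteq> 0" "q (k + n) = q k" for k
  proof -
    have "perp (q k) \<in> L" "q k \<noteq> 0" using pole n l(1) by (auto simp: q_def)
    then show "B (q k) (q k) \<noteq> 0"
      using no_line_tangent[OF assms(2,3)] assms(4,7) meet by metis
    show "q (k + n) = q k" by (simp add: q_def)
  qed
  have on: "A ! k \<subseteq> perp (q i) \<longleftrightarrow> k mod n = i" if "i < n" "k < 2 * n" for i k
    using l(2)[OF that] pole(2) that by (simp add: q_def)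
  have "\<exists>z. isotropic z \<and> s = perp z" if "s \<in> set (sides A)" for s
    using A(3) that unfolding circ by blast
  then obtain w where w: "generic q n w" "\<And>k v. reflections q (k + 2 * n) v = reflections q k v"
    using polygon_generic[of n q A, OF n q A(1) _ on] by blast
  have X: "finite ?X"
    using generic_points_are_vertices[of n q L w, OF n q L w] unfolding circ .
  moreover have "infinite ?S"
  proof
    assume "finite ?S"
    then have "finite (?X \<union> (\<Union>A\<in>?S. set A))" using X by simp
    moreover have "points_of L \<subseteq> ?X \<union> (\<Union>A\<in>?S. set A)" by blast
    ultimately have fin: "finite (points_of L)" using finite_subset by blast
    have 0: "l 0 \<in> L" using l(1) n by force
    then have "{p \<in> proj_points. p \<subseteq> l 0} \<subseteq> points_of L" unfolding points_of_def by blast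
    then show False
      using infinite_points_on_line[of "l 0"] 0 assms(2) fin finite_subset by blast
  qed
  ultimately show ?thesis by blast
qed

end
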